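(* Let $n\ge 0$ and let $\sigma\in I_n$ be an inversion sequence of length $n$. Then $\Theta(\sigma)=\sigma$ if and only if the following two conditions hold: (i) $\sigma$ avoids the pattern $101$; (ii) whenever a value $v$ appears in $\sigma$ (i.e. $v=\sigma_p$ for some $p\in[1,n]$), one has $\sigma_{v+1}=v$.
   Context: For integers $a\le b$, $[a,b]=\{i\in\mathbb Z: a\le i\le b\}$. $I_n$ is the set of inversion sequences of length $n$, i.e. integer sequences $\sigma=(\sigma_1,\ldots,\sigma_n)$ with $0\le\sigma_i<i$ for every $i\in[1,n]$. For a finite integer sequence $\sigma$ of length $n$, $\Theta(\sigma)$ is the sequence of length $n$ defined by $\Theta(\sigma)_i=\#\{j<i:\sigma_j<\sigma_i\}$ for $i\in[1,n]$. A sequence avoids $101$ if there are no indices $a<b<c$ with $\sigma_a=\sigma_c>\sigma_b$. *)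

theory Defs
  imports Main
begin

text \<open>
  A finite integer sequence is an \<open>int list\<close>. All indices below are 1-based, through
  the accessor \<open>entry\<close>; it is only meaningful for positions in \<open>{1..length \<sigma>}\<close>.
\<close>

definition entry :: "'a list \<Rightarrow> nat \<Rightarrow> 'a"
  where "entry \<sigma> i = \<sigma> ! (i - 1)"

definition inversion_seqs :: "nat \<Rightarrow> int list set"
  where "inversion_seqs n =
    {\<sigma>. length \<sigma> = n \<and> (\<forall>i\<in>{1..n}. 0 \<le> entry \<sigma> i \<and> entry \<sigma> i < int i)}"

definition Theta :: "int list \<Rightarrow> int list"
  where "Theta \<sigma> =
    map (\<lambda>i. int (card {j \<in> {1..<i}. entry \<sigma> j < entry \<sigma> i})) [1..<Suc (length \<sigma>)]"

definition avoids_101 :: "int list \<Rightarrow> bool"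
  where "avoids_101 \<sigma> \<longleftrightarrow>
    \<not> (\<exists>a\<in>{1..length \<sigma>}. \<exists>b\<in>{1..length \<sigma>}. \<exists>c\<in>{1..length \<sigma>}.
        a < b \<and> b < c \<and> entry \<sigma> a = entry \<sigma> c \<and> entry \<sigma> c > entry \<sigma> b)"

lemma length_Theta: "length (Theta \<sigma>) = length \<sigma>"
  unfolding Theta_def by (simp del: upt_Suc)

lemma entry_Theta:
  assumes "i \<in> {1..length \<sigma>}"
  shows "entry (Theta \<sigma>) i = int (card {j \<in> {1..<i}. entry \<sigma> j < entry \<sigma> i})"
proof -
  have "[1..<Suc (length \<sigma>)] ! (i - 1) = i"
    using assms by (subst nth_upt) auto
  moreover have "i - 1 < length [1..<Suc (length \<sigma>)]"
    using assms by auto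
  ultimately show ?thesis
    unfolding Theta_def entry_def[of "map _ _"] by (simp only: nth_map)
qed

end

theory Submission
  imports Defs
begin

text \<open>
  Since \<open>\<sigma>\<^sub>j < j\<close>, each position \<open>j \<le> \<sigma>\<^sub>i\<close> counts towards \<open>\<Theta>(\<sigma>)\<^sub>i\<close>, so
  \<open>\<Theta>(\<sigma>)\<^sub>i \<ge> \<sigma>\<^sub>i\<close>, with equality iff no position strictly between \<open>\<sigma>\<^sub>i\<close> and \<open>i\<close> carries a
  smaller entry. If equality holds everywhere, a value \<open>v = \<sigma>\<^sub>p\<close> forces
  \<open>v \<le> \<sigma>\<^bsub>v+1\<^esub> < v + 1\<close>; conversely, when \<open>\<sigma>\<^bsub>v+1\<^esub> = v\<close>, a smaller entry in between
  completes a pattern 101 starting at position \<open>v + 1\<close>.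
\<close>

lemma Theta_eq_iff:
  "Theta \<sigma> = \<sigma> \<longleftrightarrow> (\<forall>i\<in>{1..length \<sigma>}. entry (Theta \<sigma>) i = entry \<sigma> i)"
proof
  assume entries: "\<forall>i\<in>{1..length \<sigma>}. entry (Theta \<sigma>) i = entry \<sigma> i"
  show "Theta \<sigma> = \<sigma>"
  proof (rule nth_equalityI)
    fix k assume "k < length (Theta \<sigma>)"
    then have "Suc k \<in> {1..length \<sigma>}" by (simp add: length_Theta)
    with entries have "entry (Theta \<sigma>) (Suc k) = entry \<sigma> (Suc k)" by blast
    then show "Theta \<sigma> ! k = \<sigma> ! k" by (simp add: entry_def)
  qed (simp add: length_Theta)
qed simp

text \<open>With \<open>k\<close> the value at \<open>i\<close>, the counted set always contains
  \<open>{1..k}\<close>, so the count equals \<open>k\<close> iff no further position is counted.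
  This trades cardinalities for pointwise inequalities.\<close>

lemma entry_Theta_eq_iff:
  assumes "\<sigma> \<in> inversion_seqs n" and i: "i \<in> {1..n}"
  shows "entry (Theta \<sigma>) i = entry \<sigma> i \<longleftrightarrow>
    (\<forall>j\<in>{1..<i}. entry \<sigma> i < int j \<longrightarrow> entry \<sigma> i \<le> entry \<sigma> j)"
proof -
  have len: "length \<sigma> = n"
    and bounds: "\<And>j. j \<in> {1..n} \<Longrightarrow> 0 \<le> entry \<sigma> j \<and> entry \<sigma> j < int j"
    using assms(1) by (auto simp: inversion_seqs_def)
  define k where "k = nat (entry \<sigma> i)"
  have k: "entry \<sigma> i = int k" "k < i" using bounds[OF i] by (auto simp: k_def)
  let ?D = "{j \<in> {1..<i}. entry \<sigma> j < entry \<sigma> i}"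
  have sub: "{1..k} \<subseteq> ?D"
  proof
    fix j assume "j \<in> {1..k}"
    then show "j \<in> ?D" using bounds[of j] k i by auto
  qed
  have "entry (Theta \<sigma>) i = entry \<sigma> i \<longleftrightarrow> card ?D = card {1..k}"
    using entry_Theta[of i \<sigma>] i len k by simp
  also have "\<dots> \<longleftrightarrow> ?D = {1..k}"
  proof
    assume "card ?D = card {1..k}"
    then have "{1..k} = ?D" by (intro card_subset_eq[OF _ sub]) simp_all
    then show "?D = {1..k}" by (rule sym)
  qed (rule arg_cong)
  also have "\<dots> \<longleftrightarrow> ?D \<subseteq> {1..k}"
    by (simp only: set_eq_subset sub simp_thms)
  also have "\<dots> \<longleftrightarrow> (\<forall>j\<in>{1..<i}. entry \<sigma> i < int j \<longrightarrow> entry \<sigma> i \<le> entry \<sigma> j)"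
  \<comment> \<open>Counted positions outside \<open>{1..k}\<close> are exactly the counterexamples
    to the right-hand side.\<close>
  proof -
    have "j \<in> ?D \<and> j \<notin> {1..k} \<longleftrightarrow>
        j \<in> {1..<i} \<and> entry \<sigma> i < int j \<and> \<not> entry \<sigma> i \<le> entry \<sigma> j" for j
      using k(1) by auto
    then show ?thesis by blast
  qed
  finally show ?thesis .
qed

theorem theorem4p5:
  fixes n :: nat and \<sigma> :: "int list"
  assumes "\<sigma> \<in> inversion_seqs n"
  shows "Theta \<sigma> = \<sigma> \<longleftrightarrow>
    avoids_101 \<sigma> \<and>
    (\<forall>v. (\<exists>p\<in>{1..n}. v = entry \<sigma> p) \<longrightarrow> entry \<sigma> (nat (v + 1)) = v)"
proof -
  have len: "length \<sigma> = n"
    and bounds: "\<And>j. j \<in> {1..n} \<Longrightarrow> 0 \<le> entry \<sigma> j \<and> entry \<sigma> j < int j"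
    using assms by (auto simp: inversion_seqs_def)
  have fixpoint: "Theta \<sigma> = \<sigma> \<longleftrightarrow>
      (\<forall>i\<in>{1..n}. \<forall>j\<in>{1..<i}. entry \<sigma> i < int j \<longrightarrow> entry \<sigma> i \<le> entry \<sigma> j)"
    using entry_Theta_eq_iff[OF assms] by (simp add: Theta_eq_iff len)
  show ?thesis
  proof (intro iffI conjI allI impI)
    assume "Theta \<sigma> = \<sigma>"
    then have ge: "entry \<sigma> i \<le> entry \<sigma> j"
      if "i \<in> {1..n}" "j \<in> {1..<i}" "entry \<sigma> i < int j" for i j
      using that fixpoint by blast
    show "avoids_101 \<sigma>"
      unfolding avoids_101_def len
    proof clarify
      fix a b c
      assume *: "a \<in> {1..n}" "b \<in> {1..n}" "c \<in> {1..n}" "a < b" "b < c"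
        "entry \<sigma> a = entry \<sigma> c" "entry \<sigma> b < entry \<sigma> c"
      \<comment> \<open>The repeated value already occurs at \<open>a\<close>, so it is below
        \<open>a\<close> and hence below \<open>b\<close>; thus \<open>ge\<close> applies to
        \<open>c\<close> and \<open>b\<close>.\<close>
      then have "entry \<sigma> c < int b" using bounds[of a] by simp
      then show False using ge[of c b] * by simp
    qed
    fix v assume "\<exists>p\<in>{1..n}. v = entry \<sigma> p"
    then obtain p where p: "p \<in> {1..n}" "v = entry \<sigma> p" by blast
    let ?q = "nat (v + 1)"
    \<comment> \<open>From \<open>0 \<le> v < p\<close>, the conversion by \<open>nat\<close> is
      exact and position \<open>v + 1\<close> does not exceed \<open>p\<close>.\<close>
    have q: "?q \<in> {1..n}" "int ?q = v + 1" "?q \<le> p" using bounds[OF p(1)] p by auto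
    show "entry \<sigma> ?q = v"
    \<comment> \<open>\<open>ge\<close> needs a position strictly before \<open>p\<close>, so
      \<open>?q = p\<close> is split off.\<close>
    proof (cases "?q = p")
      case False
      then have "v \<le> entry \<sigma> ?q" using ge[of p ?q] p q by simp
      then show ?thesis using bounds[OF q(1)] q by simp
    qed (simp add: p)
  next
    assume *: "avoids_101 \<sigma> \<and>
      (\<forall>v. (\<exists>p\<in>{1..n}. v = entry \<sigma> p) \<longrightarrow> entry \<sigma> (nat (v + 1)) = v)"
    have "entry \<sigma> i \<le> entry \<sigma> j"
      if i: "i \<in> {1..n}" and j: "j \<in> {1..<i}" and less: "entry \<sigma> i < int j" for i j
    proof (rule ccontr)
      assume smaller: "\<not> entry \<sigma> i \<le> entry \<sigma> j"
      let ?q = "nat (entry \<sigma> i + 1)"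
      have q: "entry \<sigma> ?q = entry \<sigma> i" using * i by blast
      \<comment> \<open>\<open>less\<close> only gives \<open>?q \<le> j\<close>; the differing
        entries make it strict, so \<open>?q < j < i\<close> is a 101.\<close>
      then have "?q \<noteq> j" using smaller by auto
      then have "?q \<in> {1..n}" "j \<in> {1..n}" "?q < j" "j < i"
        using bounds[OF i] i j less by auto
      moreover have "entry \<sigma> j < entry \<sigma> i" using smaller by simp
      ultimately show False using * q i unfolding avoids_101_def len by blast
    qed
    then show "Theta \<sigma> = \<sigma>" using fixpoint by blast
  qed
qed

end
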